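(* Let $$\varphi(c)=c+B_0+\frac{B_1}{c}+\dots+\frac{B_\ell}{c^\ell}+\dots$$ be a formal Laurent series and let $$\psi(w)=w+C_0+\frac{C_1}{w}+\dots+\frac{C_\ell}{w^\ell}+\dots$$ be its formal (compositional) inverse. Assume that for every $\ell=0,1,2,\dots$ the coefficient $B_\ell$ is of the form $B_\ell=\frac{R_\ell}{2^{p_\ell}}$, where $R_\ell$ is an odd integer and $$p_\ell=\ell+1+\mathrm{ord}((\ell+1)!)=\mathrm{ord}((2\ell+2)!).$$ Then for every $\ell\ge 0$ the coefficient $C_\ell$ is either zero or of the form $C_\ell=\frac{K_\ell}{2^{q_\ell}}$, where $K_\ell$ is an odd integer and $q_\ell$ is an integer satisfying $$q_\ell\le p_\ell=\ell+1+\mathrm{ord}((\ell+1)!).$$ Moreover, equality holds (that is, $C_\ell\neq 0$ and $q_\ell=p_\ell$) if and only if either $\ell=0$ or $\ell$ is odd.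
   Context: For a nonzero integer $m$, $\mathrm{ord}(m)$ denotes the exponent of the largest power of $2$ dividing $m$ (the 2-adic valuation). The formal inverse of a formal Laurent series $\varphi(c)=c+B_0+B_1/c+\dots$ is the unique formal Laurent series $\psi(w)=w+C_0+C_1/w+\dots$ such that $\psi(\varphi(c))=c$ and $\varphi(\psi(w))=w$ as formal Laurent series in $1/c$ and $1/w$ respectively. *)

theory Defs
  imports "HOL-Computational_Algebra.Computational_Algebra"
begin

abbreviation ord2 :: "int \<Rightarrow> nat" where
  "ord2 m \<equiv> multiplicity 2 m"

definition p_exp :: "nat \<Rightarrow> nat" where
  "p_exp l = l + 1 + ord2 (fact (l + 1))"

lemma ord2_fact_double: "ord2 (fact (2 * n)) = n + ord2 (fact n)"
proof (induction n)
  case (Suc n)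
  have 1: "(fact (2 * Suc n) :: int) = 2 * (int (Suc n) * ((2 * int n + 1) * fact (2 * n)))"
    by (simp add: algebra_simps)
  have p: "prime_elem (2::int)" by simp
  have 2: "ord2 (2 * int n + 1) = 0"
    by (rule not_dvd_imp_multiplicity_0) presburger
  have nz: "2 * int n + 1 \<noteq> 0" "int (Suc n) \<noteq> 0" "(fact (2 * n) :: int) \<noteq> 0"
    "(fact n :: int) \<noteq> 0"
    by auto
  have "ord2 (fact (2 * Suc n)) = 1 + ord2 (int (Suc n)) + ord2 (fact (2 * n))"
    unfolding 1 using nz 2
    by (simp add: prime_elem_multiplicity_mult_distrib[OF p] del: of_nat_Suc)
  moreover have "ord2 (fact (Suc n)) = ord2 (int (Suc n)) + ord2 (fact n)"
    unfolding fact_Suc of_nat_eq_id using nz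
    by (simp add: prime_elem_multiplicity_mult_distrib[OF p] del: of_nat_Suc)
  ultimately show ?case using Suc by simp
qed simp

lemma p_exp_altdef: "p_exp l = ord2 (fact (2 * l + 2))"
  using ord2_fact_double[of "l + 1"] by (simp add: p_exp_def del: fact_Suc)

text \<open>
  A formal Laurent series \<open>c + a 0 + a 1 / c + a 2 / c\<^sup>2 + \<dots>\<close> at infinity is represented
  as an element of \<^typ>\<open>'a fls\<close> in the variable \<open>X = 1 / c\<close>, so that \<open>c\<close> itself is
  \<^term>\<open>fls_X_inv\<close> and the coefficient of \<open>1 / c ^ l\<close> is the coefficient at index \<open>l\<close>.
\<close>

definition laurent_inf :: "(nat \<Rightarrow> 'a::field) \<Rightarrow> 'a fls" where
  "laurent_inf a = fls_X_inv + fps_to_fls (Abs_fps a)"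

lemma laurent_inf_nth:
  "fls_nth (laurent_inf a) n = (if n = -1 then 1 else if n < 0 then 0 else a (nat n))"
  by (simp add: laurent_inf_def)

text \<open>
  The composition \<open>F(G(c))\<close> of series at infinity: as \<open>F\<close> is a series in \<open>1 / w\<close>, one substitutes
  \<open>1 / w = 1 / G(c)\<close>. If \<open>G\<close> has a pole at \<open>c = \<infinity>\<close>, then \<open>1 / G\<close> is a power series
  in \<open>1 / c\<close> without constant term, so \<^const>\<open>fls_regpart\<close> only changes its type.
\<close>

definition compose_inf :: "'a::field fls \<Rightarrow> 'a fls \<Rightarrow> 'a fls" where
  "compose_inf F G = fls_compose_fps F (fls_regpart (inverse G))"

lemma fps_to_fls_regpart_inverse:
  fixes G :: "'a::field fls"
  assumes "fls_subdegree G < 0"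
  shows "fps_to_fls (fls_regpart (inverse G)) = inverse G"
    and "fls_regpart (inverse G) \<noteq> 0"
    and "fps_nth (fls_regpart (inverse G)) 0 = 0"
proof -
  have G: "G \<noteq> 0" using assms by auto
  hence sd: "fls_subdegree (inverse G) = - fls_subdegree G"
    by (simp add: fls_inverse_subdegree)
  show 1: "fps_to_fls (fls_regpart (inverse G)) = inverse G"
    using assms sd by (intro fls_regpart_to_fls_trivial) simp
  show "fls_regpart (inverse G) \<noteq> 0"
    using 1 G by (metis fps_zero_to_fls nonzero_imp_inverse_nonzero)
  show "fps_nth (fls_regpart (inverse G)) 0 = 0"
    using assms sd by simp
qed

lemma fls_subdegree_laurent_inf [simp]: "fls_subdegree (laurent_inf a) = -1"
  by (rule fls_subdegree_eqI) (auto simp: laurent_inf_nth)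

lemma compose_inf_laurent_inf:
  "compose_inf (laurent_inf a) (laurent_inf b) =
     laurent_inf b + fps_to_fls (fps_compose (Abs_fps a) (fls_regpart (inverse (laurent_inf b))))"
proof -
  have sd: "fls_subdegree (laurent_inf b) < 0" by simp
  note H = fps_to_fls_regpart_inverse[OF sd]
  have "fls_compose_fps fls_X_inv (fls_regpart (inverse (laurent_inf b)))
          = inverse (fps_to_fls (fls_regpart (inverse (laurent_inf b))))"
    using fls_compose_fps_shift[OF H(2), of 1 1]
    by (simp add: power_int_minus fls_X_inv_conv_shift_1)
  also have "\<dots> = laurent_inf b"
    by (simp add: H(1))
  finally show ?thesis
    unfolding compose_inf_def laurent_inf_def[of a] using H
    by (simp add: fls_compose_fps_add)
qed

definition formal_inverse_inf :: "'a::field fls \<Rightarrow> 'a fls \<Rightarrow> bool" where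
  "formal_inverse_inf \<phi> \<psi> \<longleftrightarrow>
     (\<exists>a. \<psi> = laurent_inf a) \<and> compose_inf \<psi> \<phi> = fls_X_inv \<and> compose_inf \<phi> \<psi> = fls_X_inv"

end

theory Submission
  imports Defs "HOL-Number_Theory.Cong"
begin

text \<open>
  Write \<open>\<phi>(c) = c A(1 / c)\<close> with \<open>A = 1 + B 0 X + B 1 X\<^sup>2 + \<dots>\<close>. Taking residues under the
  substitution \<open>w = \<phi>(c)\<close> gives the Lagrange inversion formula at infinity: for \<open>l > 0\<close>,
  \<open>l C l\<close> is minus the coefficient of \<open>X\<^bsup>l+1\<^esup>\<close> in \<open>A\<^sup>l\<close> (lemma \<open>lagrange_inversion_inf\<close>).
  Differentiating \<open>A\<^sup>l\<close> turns this into a formula for \<open>(l + 1) C l\<close>, namely minus the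
  coefficient of \<open>X\<^sup>l\<close> in \<open>A' A\<^bsup>l-1\<^esup>\<close>.

  The hypothesis on \<open>B\<close> says that the rescaled series \<open>A(2X)\<close> has the form
  \<open>\<Sum>n. a n X\<^sup>n / n!\<close> with every \<open>a n\<close> an odd integer; so modulo 2 the \<open>a n\<close> agree with the
  corresponding numbers 1 of the exponential series. Series with integral coefficients in this
  sense (Hurwitz series) are closed under multiplication and differentiation, and both
  operations respect congruences. Hence \<open>2\<^bsup>l+1\<^esup> (l + 1)! C l\<close> is an integer, and its parity
  is the one that it has in the case \<open>A(2X) = exp X\<close>. There \<open>(A(2X))' A(2X)\<^bsup>l-1\<^esup>\<close> is
  \<open>exp (l X)\<close>, so the parity is that of \<open>l\<^sup>l\<close>: the integer is odd exactly for odd \<open>l\<close>.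
  The coefficient \<open>C 0 = - B 0\<close> is read off directly.

  It remains to remove the odd part of \<open>(l + 1)!\<close> from the denominator. Both \<open>l C l\<close> and
  \<open>(l + 1) C l\<close> are polynomials with integer coefficients in the coefficients of \<open>A\<close>, which are
  dyadic rationals; so their difference \<open>C l\<close> is a dyadic rational as well.
\<close>

section \<open>Residues and Lagrange inversion at infinity\<close>

lemma fls_deriv_compose_fps:
  fixes F :: "'a::field fls"
  assumes H: "H \<noteq> 0" "fps_nth H 0 = 0"
  shows "fls_deriv (fls_compose_fps F H)
           = fls_compose_fps (fls_deriv F) H * fps_to_fls (fps_deriv H)"
proof -
  \<comment> \<open>Clearing the pole of \<open>F\<close> reduces the claim to the chain rule for power series.\<close>
  obtain k :: nat and A where A: "F * fls_X ^ k = fps_to_fls A"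
  proof -
    define k where "k = nat (- fls_subdegree F)"
    obtain A where "F = fls_shift (int k) (fps_to_fls A)"
    proof (rule fls_as_fps)
      show "- fls_subdegree F \<le> int k" by (simp add: k_def)
    qed
    hence "F * fls_X ^ k = fps_to_fls A"
      by (simp add: fls_X_power_times_conv_shift fls_shifted_times_transfer)
    thus ?thesis by (rule that)
  qed
  define h where "h = fps_to_fls H"
  define G where "G = fls_compose_fps F H"
  define G' where "G' = fls_compose_fps (fls_deriv F) H"
  have h: "h \<noteq> 0" using H by (simp add: h_def)
  have h': "fls_deriv h = fps_to_fls (fps_deriv H)"
    by (simp add: h_def fls_deriv_fps_to_fls)
  have "G * h ^ k = fls_compose_fps (fps_to_fls A) H"
    by (simp only: A [symmetric] fls_compose_fps_mult[OF H] fls_compose_fps_power[OF H]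
        fls_compose_fps_X G_def h_def)
  hence GA: "G * h ^ k = fps_to_fls (fps_compose A H)" using H by simp
  have "fps_to_fls (fps_deriv A) = F * (of_nat k * fls_X ^ (k - 1)) + fls_deriv F * fls_X ^ k"
    by (simp add: fls_deriv_fps_to_fls [symmetric] A [symmetric] fls_deriv_X_power)
  hence "fls_compose_fps (fps_to_fls (fps_deriv A)) H
           = G * (of_nat k * h ^ (k - 1)) + G' * h ^ k"
    by (simp only: fls_compose_fps_mult[OF H] fls_compose_fps_power[OF H] fls_compose_fps_add[OF H]
        fls_compose_fps_X fls_compose_fps_of_nat G_def G'_def h_def)
  hence A': "fps_to_fls (fps_compose (fps_deriv A) H) = G * (of_nat k * h ^ (k - 1)) + G' * h ^ k"
    using H by simp
  have "fls_deriv (G * h ^ k) = fps_to_fls (fps_compose (fps_deriv A) H) * fls_deriv h"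
    by (simp add: GA fls_deriv_fps_to_fls fps_compose_deriv H h' fls_times_fps_to_fls)
  hence "fls_deriv G * h ^ k = G' * fls_deriv h * h ^ k"
    unfolding A' by (simp add: fls_deriv_power algebra_simps)
  thus ?thesis using h by (simp add: G_def G'_def h')
qed

text \<open>
  In characteristic 0 a series differs from its residue term by a derivative. The substitution
  turns the derivative into a derivative, which has no residue, and the term \<open>1 / X\<close> into the
  logarithmic derivative of \<open>H\<close>.
\<close>

lemma fls_residue_compose_fps:
  fixes F :: "'a::field_char_0 fls"
  assumes H: "H \<noteq> 0" "fps_nth H 0 = 0"
  shows "fls_residue (fls_compose_fps F H * fps_to_fls (fps_deriv H))
           = of_nat (subdegree H) * fls_residue F"
proof -
  define r where "r = fls_residue F"
  have "fls_residue (F - fls_const r * fls_X_inv) = 0"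
    by (simp add: r_def)
  then obtain T where T: "F - fls_const r * fls_X_inv = fls_deriv T"
    using fls_residue_nonzero_ex_antiderivative by metis
  have F: "F = fls_deriv T + fls_const r * fls_X_inv"
    using T by (simp add: algebra_simps)
  have inv: "fls_compose_fps fls_X_inv H = inverse (fps_to_fls H)"
    using fls_compose_fps_inverse[OF H, of fls_X] by (simp add: fls_inverse_X)
  have "fls_compose_fps F H * fps_to_fls (fps_deriv H)
          = fls_deriv (fls_compose_fps T H)
            + fls_const r * (inverse (fps_to_fls H) * fls_deriv (fps_to_fls H))"
    by (subst F) (simp add: fls_compose_fps_add[OF H] fls_compose_fps_mult[OF H]
        fls_deriv_compose_fps[OF H] inv algebra_simps fls_deriv_fps_to_fls)
  hence "fls_residue (fls_compose_fps F H * fps_to_fls (fps_deriv H))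
           = r * fls_residue (inverse (fps_to_fls H) * fls_deriv (fps_to_fls H))"
    by (simp only: fls_residue_add fls_residue_deriv fls_residue_fls_const_times add_0)
  also have "\<dots> = of_nat (subdegree H) * r"
    by (simp only: fls_residue_deriv_times_inverse_eq_subdegree)
       (simp add: fls_subdegree_fls_to_fps)
  finally show ?thesis by (simp only: r_def)
qed

definition cofactor_inf :: "(nat \<Rightarrow> 'a::field) \<Rightarrow> 'a fps" where
  "cofactor_inf a = Abs_fps (\<lambda>n. if n = 0 then 1 else a (n - 1))"

lemma cofactor_inf_nth [simp]:
  "fps_nth (cofactor_inf a) 0 = 1" "fps_nth (cofactor_inf a) (Suc n) = a n"
  by (simp_all add: cofactor_inf_def)

lemma laurent_inf_conv_cofactor: "laurent_inf a = fls_X_inv * fps_to_fls (cofactor_inf a)"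
proof -
  have "laurent_inf a = fls_shift 1 (fps_to_fls (cofactor_inf a))"
    by (rule fls_eqI) (auto simp: laurent_inf_nth cofactor_inf_def nat_diff_distrib nat_add_distrib)
  thus ?thesis by (simp only: fls_X_inv_times_conv_shift)
qed

text \<open>
  The coefficient \<open>l C l\<close> is the residue of \<open>w\<^sup>l \<psi>'(w)\<close> in the variable \<open>1 / w\<close>. Substituting
  \<open>w = \<phi>(c)\<close> turns \<open>\<psi>'\<close> into the derivative of \<open>c\<close> and leaves a coefficient of \<open>\<phi>(c)\<^sup>l\<close>.
\<close>

lemma lagrange_inversion_inf:
  fixes B C :: "nat \<Rightarrow> 'a::field_char_0"
  assumes inv: "compose_inf (laurent_inf C) (laurent_inf B) = fls_X_inv"
    and l: "l > 0"
  shows "of_nat l * C l = - fps_nth (cofactor_inf B ^ l) (Suc l)"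
proof -
  define F G where "F = laurent_inf B" and "G = laurent_inf C"
  define H where "H = fls_regpart (inverse F)"
  have sd: "fls_subdegree F < 0" by (simp add: F_def)
  note H0 = fps_to_fls_regpart_inverse[OF sd, folded H_def]
  note H = H0(2,3)
  have "int (subdegree H) = fls_subdegree (inverse F)"
    by (simp add: H0(1) [symmetric] fls_subdegree_fls_to_fps)
  also have "\<dots> = 1" by (simp add: fls_inverse_subdegree F_def)
  finally have sH: "subdegree H = 1" by simp
  have GH: "fls_compose_fps G H = fls_X_inv"
    using inv by (simp add: compose_inf_def F_def G_def H_def)
  have XH: "fls_compose_fps fls_X_inv H = F"
    using fls_compose_fps_inverse[OF H, of fls_X] H0(1) by (simp add: fls_inverse_X)
  have Fl: "F ^ l = fls_shift (int l) (fps_to_fls (cofactor_inf B ^ l))"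
    by (simp add: F_def laurent_inf_conv_cofactor power_mult_distrib fls_X_inv_power_times_conv_shift
        fps_to_fls_power)
  have "of_nat l * C l = fls_residue (fls_X_inv ^ l * fls_deriv G)"
    using l by (simp add: fls_X_inv_power_times_conv_shift G_def laurent_inf_nth)
  also have "\<dots> = fls_residue (fls_compose_fps (fls_X_inv ^ l * fls_deriv G) H
                                * fps_to_fls (fps_deriv H))"
    by (simp only: fls_residue_compose_fps[OF H] sH of_nat_1 mult_1)
  also have "fls_compose_fps (fls_X_inv ^ l * fls_deriv G) H * fps_to_fls (fps_deriv H)
               = F ^ l * fls_deriv (fls_compose_fps G H)"
    by (simp add: fls_compose_fps_mult[OF H] fls_compose_fps_power[OF H] XH
        fls_deriv_compose_fps[OF H])
  also have "\<dots> = - (fls_X_inv\<^sup>2 * F ^ l)"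
    by (simp add: GH)
  also have "fls_residue \<dots> = - fps_nth (cofactor_inf B ^ l) (Suc l)"
    by (simp add: fls_X_inv_power_times_conv_shift Fl nat_add_distrib)
  finally show ?thesis .
qed

lemma inverse_inf_nth_0:
  fixes B C :: "nat \<Rightarrow> 'a::field_char_0"
  assumes inv: "compose_inf (laurent_inf C) (laurent_inf B) = fls_X_inv"
  shows "C 0 = - B 0"
proof -
  have "fls_nth (laurent_inf B + fps_to_fls (fps_compose (Abs_fps C)
           (fls_regpart (inverse (laurent_inf B))))) 0 = fls_nth (fls_X_inv :: 'a fls) 0"
    using inv by (simp only: compose_inf_laurent_inf)
  thus ?thesis by (simp add: laurent_inf_nth add_eq_0_iff)
qed

section \<open>Congruences between Hurwitz series\<close>

text \<open>
  A Hurwitz series is \<open>\<Sum>n. a n X\<^sup>n / n!\<close> with integers \<open>a n\<close>. The relation contains the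
  integrality of both series, because congruence of the coefficients makes no sense without it.
\<close>

definition hurwitz_cong :: "int \<Rightarrow> 'a::field_char_0 fps \<Rightarrow> 'a fps \<Rightarrow> bool" where
  "hurwitz_cong m F G \<longleftrightarrow>
     (\<forall>n. \<exists>a b. fact n * fps_nth F n = of_int a \<and> fact n * fps_nth G n = of_int b
              \<and> [a = b] (mod m))"

lemma hurwitz_cong_deriv:
  assumes "hurwitz_cong m F G"
  shows "hurwitz_cong m (fps_deriv F) (fps_deriv G)"
proof -
  have shift: "fact n * fps_nth (fps_deriv F) n = fact (Suc n) * fps_nth F (Suc n)"
    for F :: "'a fps" and n
    by (simp add: algebra_simps)
  show ?thesis
    unfolding hurwitz_cong_def shift using assms unfolding hurwitz_cong_def by blast
qed

text \<open>The coefficients of a product are binomial convolutions, which have integer weights.\<close>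

lemma hurwitz_cong_mult:
  assumes "hurwitz_cong m F F'" "hurwitz_cong m G G'"
  shows "hurwitz_cong m (F * G) (F' * G')"
proof -
  from assms(1) obtain a a' where a: "\<And>n. fact n * fps_nth F n = of_int (a n)"
    "\<And>n. fact n * fps_nth F' n = of_int (a' n)" "\<And>n. [a n = a' n] (mod m)"
    unfolding hurwitz_cong_def by metis
  from assms(2) obtain b b' where b: "\<And>n. fact n * fps_nth G n = of_int (b n)"
    "\<And>n. fact n * fps_nth G' n = of_int (b' n)" "\<And>n. [b n = b' n] (mod m)"
    unfolding hurwitz_cong_def by metis
  have conv: "fact n * fps_nth (F * G) n = of_int (\<Sum>i=0..n. int (n choose i) * (a i * b (n - i)))"
    if "\<And>n. fact n * fps_nth F n = of_int (a n)" "\<And>n. fact n * fps_nth G n = of_int (b n)"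
    for F G :: "'a fps" and a b n
  proof -
    have "fact n * (fps_nth F i * fps_nth G (n - i))
            = of_nat (n choose i) * (of_int (a i) * of_int (b (n - i)))" if "i \<le> n" for i
    proof -
      have "(fact n :: 'a) = of_nat (n choose i) * (fact i * fact (n - i))"
        using binomial_fact_lemma[OF \<open>i \<le> n\<close>]
        by (metis mult.commute of_nat_fact of_nat_mult)
      thus ?thesis
        by (simp add: \<open>\<And>n. fact n * fps_nth F n = of_int (a n)\<close> [symmetric]
            \<open>\<And>n. fact n * fps_nth G n = of_int (b n)\<close> [symmetric] mult_ac)
    qed
    thus ?thesis by (simp add: fps_mult_nth sum_distrib_left)
  qed
  have "[(\<Sum>i=0..n. int (n choose i) * (a i * b (n - i)))
          = (\<Sum>i=0..n. int (n choose i) * (a' i * b' (n - i)))] (mod m)" for n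
    by (intro cong_sum cong_mult cong_refl a b)
  thus ?thesis
    unfolding hurwitz_cong_def using conv[OF a(1) b(1)] conv[OF a(2) b(2)] by blast
qed

lemma hurwitz_cong_one: "hurwitz_cong m 1 1"
  unfolding hurwitz_cong_def
proof (intro allI)
  fix n :: nat
  show "\<exists>a b. fact n * fps_nth 1 n = (of_int a :: 'a) \<and> fact n * fps_nth 1 n = (of_int b :: 'a)
          \<and> [a = b] (mod m)"
    by (rule exI[of _ "if n = 0 then 1 else 0"])+ simp
qed

lemma hurwitz_cong_power: "hurwitz_cong m F G \<Longrightarrow> hurwitz_cong m (F ^ k) (G ^ k)"
  by (induction k) (simp_all add: hurwitz_cong_one hurwitz_cong_mult)

section \<open>Dyadic rationals\<close>

definition dyadic :: "'a::field_char_0 \<Rightarrow> bool" where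
  "dyadic x \<longleftrightarrow> (\<exists>(k::nat) (a::int). x * 2 ^ k = of_int a)"

lemma dyadic_of_int [simp]: "dyadic (of_int a)"
  unfolding dyadic_def by (intro exI[of _ 0] exI[of _ a]) simp

lemma dyadic_0 [simp]: "dyadic 0" and dyadic_1 [simp]: "dyadic 1"
  using dyadic_of_int[of 0] dyadic_of_int[of 1] by simp_all

lemma dyadic_add:
  assumes "dyadic x" "dyadic y"
  shows "dyadic (x + y)"
proof -
  obtain j k :: nat and a b :: int where "x * 2 ^ j = of_int a" "y * 2 ^ k = of_int b"
    using assms unfolding dyadic_def by blast
  hence "(x * 2 ^ j) * 2 ^ k + (y * 2 ^ k) * 2 ^ j = of_int (a * 2 ^ k + b * 2 ^ j)" by simp
  hence "(x + y) * 2 ^ (j + k) = of_int (a * 2 ^ k + b * 2 ^ j)"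
    by (simp only: power_add distrib_right mult_ac)
  thus ?thesis unfolding dyadic_def by blast
qed

lemma dyadic_mult:
  assumes "dyadic x" "dyadic y"
  shows "dyadic (x * y)"
proof -
  obtain j k :: nat and a b :: int where "x * 2 ^ j = of_int a" "y * 2 ^ k = of_int b"
    using assms unfolding dyadic_def by blast
  hence "(x * 2 ^ j) * (y * 2 ^ k) = of_int (a * b)" by simp
  hence "(x * y) * 2 ^ (j + k) = of_int (a * b)" by (simp only: power_add mult_ac)
  thus ?thesis unfolding dyadic_def by blast
qed

lemma dyadic_uminus: "dyadic x \<Longrightarrow> dyadic (- x)"
  using dyadic_mult[of "of_int (-1)" x] by (simp del: of_int_minus) simp

lemma dyadic_sum: "(\<And>i. i \<in> I \<Longrightarrow> dyadic (f i)) \<Longrightarrow> dyadic (\<Sum>i\<in>I. f i)"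
  by (induction I rule: infinite_finite_induct)
     (auto intro: dyadic_add)

lemma dyadic_fps_mult_nth:
  assumes "\<And>n. dyadic (fps_nth F n)" "\<And>n. dyadic (fps_nth G n)"
  shows "dyadic (fps_nth (F * G) n)"
  unfolding fps_mult_nth by (intro dyadic_sum dyadic_mult assms)

lemma dyadic_fps_power_nth:
  assumes "\<And>n. dyadic (fps_nth F n)"
  shows "dyadic (fps_nth (F ^ k) n)"
proof (induction k arbitrary: n)
  case 0
  show ?case by simp
next
  case (Suc k)
  thus ?case by (simp add: dyadic_fps_mult_nth assms)
qed

section \<open>The coefficients of the inverse series\<close>

lemma fps_power_nth_Suc_deriv:
  fixes A :: "'a::comm_ring_1 fps"
  shows "of_nat (Suc n) * fps_nth (A ^ l) (Suc n) = of_nat l * fps_nth (fps_deriv A * A ^ (l - 1)) n"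
proof -
  have "of_nat (Suc n) * fps_nth (A ^ l) (Suc n) = fps_nth (fps_deriv (A ^ l)) n"
    by simp
  also have "fps_deriv (A ^ l) = fps_const (of_nat l) * (fps_deriv A * A ^ (l - 1))"
    by (simp add: fps_deriv_power mult.assoc)
  finally show ?thesis by simp
qed

text \<open>
  The factor \<open>l\<close> cancels after differentiating \<open>A\<^sup>l\<close>; this is what removes the denominator \<open>l\<close>
  of the Lagrange inversion formula.
\<close>

lemma lagrange_inversion_inf_deriv:
  fixes B C :: "nat \<Rightarrow> 'a::field_char_0"
  assumes inv: "compose_inf (laurent_inf C) (laurent_inf B) = fls_X_inv"
    and l: "l > 0"
  shows "of_nat (Suc l) * C l = - fps_nth (fps_deriv (cofactor_inf B) * cofactor_inf B ^ (l - 1)) l"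
proof -
  have "of_nat l * (of_nat (Suc l) * C l) = of_nat (Suc l) * (of_nat l * C l)"
    by (simp only: mult_ac)
  also have "\<dots> = - (of_nat (Suc l) * fps_nth (cofactor_inf B ^ l) (Suc l))"
    by (simp only: lagrange_inversion_inf[OF inv l] mult_minus_right)
  also have "\<dots> = of_nat l * - fps_nth (fps_deriv (cofactor_inf B) * cofactor_inf B ^ (l - 1)) l"
    by (simp only: fps_power_nth_Suc_deriv mult_minus_right)
  finally show ?thesis
    using l mult_cancel_left[of "of_nat l :: 'a"] by (metis of_nat_eq_0_iff less_irrefl)
qed

lemma dyadic_inverse_inf:
  fixes B C :: "nat \<Rightarrow> 'a::field_char_0"
  assumes inv: "compose_inf (laurent_inf C) (laurent_inf B) = fls_X_inv"
    and B: "\<And>l. dyadic (B l)" and l: "l > 0"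
  shows "dyadic (C l)"
proof -
  define A where "A = cofactor_inf B"
  have A: "dyadic (fps_nth A n)" for n
    using B by (cases n) (simp_all add: A_def)
  have A': "dyadic (fps_nth (fps_deriv A) n)" for n
    using dyadic_mult[OF dyadic_of_int[of "int (n + 1)"] A[of "n + 1"]] by simp
  have "C l = of_nat (Suc l) * C l + - (of_nat l * C l)"
    by (simp add: algebra_simps)
  also have "\<dots> = - fps_nth (fps_deriv A * A ^ (l - 1)) l + - (- fps_nth (A ^ l) (Suc l))"
    by (simp only: lagrange_inversion_inf[OF inv l] lagrange_inversion_inf_deriv[OF inv l] A_def)
  also have "dyadic \<dots>"
    by (intro dyadic_add dyadic_uminus dyadic_fps_mult_nth dyadic_fps_power_nth A A')
  finally show ?thesis .
qed

text \<open>
  The integer \<open>K\<close> is \<open>- l!\<close> times the coefficient of \<open>X\<^sup>l\<close> in \<open>F' F\<^bsup>l-1\<^esup>\<close>, where \<open>F\<close> is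
  \<open>cofactor_inf B\<close> at \<open>2 X\<close>. As \<open>F\<close> and \<open>exp X\<close> are congruent modulo 2 as Hurwitz series,
  \<open>F' F\<^bsup>l-1\<^esup>\<close> is congruent to \<open>exp (l X)\<close>, and \<open>K\<close> to \<open>l\<^sup>l\<close>.
\<close>

lemma inverse_inf_mod_2:
  fixes B C :: "nat \<Rightarrow> 'a::field_char_0"
  assumes inv: "compose_inf (laurent_inf C) (laurent_inf B) = fls_X_inv"
    and B: "\<And>l. \<exists>a. odd a \<and> 2 ^ Suc l * fact (Suc l) * B l = of_int a"
    and l: "l > 0"
  shows "\<exists>K. 2 ^ Suc l * fact (Suc l) * C l = of_int K \<and> (odd K \<longleftrightarrow> odd l)"
proof -
  define A where "A = cofactor_inf B"
  define A2 where "A2 = fps_compose A (fps_const 2 * fps_X)"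
  have A2_nth: "fps_nth A2 n = 2 ^ n * fps_nth A n" for n
    by (simp add: A2_def)
  have "hurwitz_cong 2 A2 (fps_exp 1)"
    unfolding hurwitz_cong_def
  proof
    fix n
    have "\<exists>a. odd a \<and> fact n * fps_nth A2 n = of_int a"
    proof (cases n)
      case 0
      show ?thesis by (rule exI[of _ 1]) (simp add: 0 A2_nth A_def)
    next
      case (Suc k)
      thus ?thesis using B[of k] by (simp add: A2_nth A_def mult_ac)
    qed
    then obtain a where "odd a" "fact n * fps_nth A2 n = of_int a" by blast
    moreover have "fact n * fps_nth (fps_exp 1) n = (of_int 1 :: 'a)" by simp
    ultimately show "\<exists>a b. fact n * fps_nth A2 n = of_int a
                       \<and> fact n * fps_nth (fps_exp 1) n = (of_int b :: 'a) \<and> [a = b] (mod 2)"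
      by (intro exI[of _ a] exI[of _ 1]) (simp add: cong_def odd_iff_mod_2_eq_one)
  qed
  hence "hurwitz_cong 2 (fps_deriv A2 * A2 ^ (l - 1)) (fps_deriv (fps_exp 1) * fps_exp 1 ^ (l - 1))"
    by (intro hurwitz_cong_mult hurwitz_cong_power hurwitz_cong_deriv)
  also have "fps_deriv (fps_exp 1) * fps_exp 1 ^ (l - 1) = (fps_exp 1 :: 'a fps) ^ l"
    using l by (cases l) simp_all
  also have "\<dots> = fps_exp (of_nat l)"
    by (simp add: fps_exp_power_mult)
  finally obtain a b where a: "fact l * fps_nth (fps_deriv A2 * A2 ^ (l - 1)) l = of_int a"
    and b: "fact l * fps_nth (fps_exp (of_nat l)) l = (of_int b :: 'a)" and ab: "[a = b] (mod 2)"
    unfolding hurwitz_cong_def by blast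
  have "(of_int b :: 'a) = of_int (int l ^ l)"
    using b by simp
  hence "b = int l ^ l" by (simp only: of_int_eq_iff)
  moreover have "odd a \<longleftrightarrow> odd b" using ab by (simp add: cong_def odd_iff_mod_2_eq_one)
  ultimately have "odd (- a) \<longleftrightarrow> odd l" using l by simp
  moreover have "2 ^ Suc l * fact (Suc l) * C l = of_int (- a)"
  proof -
    have "fps_deriv A2 = 2 * fps_compose (fps_deriv A) (fps_const 2 * fps_X)"
      by (simp add: A2_def fps_compose_deriv numeral_fps_const mult.commute)
    hence "fps_deriv A2 * A2 ^ (l - 1)
             = fps_const 2 * fps_compose (fps_deriv A * A ^ (l - 1)) (fps_const 2 * fps_X)"
      by (simp add: A2_def fps_compose_mult_distrib fps_compose_power numeral_fps_const mult.assoc)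
    hence "fps_nth (fps_deriv A2 * A2 ^ (l - 1)) l
             = 2 ^ Suc l * fps_nth (fps_deriv A * A ^ (l - 1)) l"
      by simp
    also have "\<dots> = - (2 ^ Suc l * (of_nat (Suc l) * C l))"
      by (simp only: lagrange_inversion_inf_deriv[OF inv l] A_def) simp
    finally have "of_int a = fact l * - (2 ^ Suc l * (of_nat (Suc l) * C l))"
      using a by simp
    also have "\<dots> = - (2 ^ Suc l * fact (Suc l) * C l)"
      by (simp only: fact_Suc of_nat_mult mult_ac mult_minus_right)
    finally show ?thesis by simp
  qed
  ultimately show ?thesis by blast
qed

lemma two_power_fact_conv_p_exp:
  obtains m :: int where "odd m" "2 ^ Suc l * fact (Suc l) = 2 ^ p_exp l * m"
proof -
  obtain m :: int where m: "fact (Suc l) = 2 ^ ord2 (fact (Suc l)) * m" "odd m"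
    using multiplicity_decompose'[of "fact (Suc l)" "2::int"] by auto
  have "2 ^ Suc l * fact (Suc l) = 2 ^ Suc l * (2 ^ ord2 (fact (Suc l)) * m)"
    by (simp only: m(1) [symmetric])
  also have "\<dots> = 2 ^ p_exp l * m"
    by (simp add: p_exp_def power_add del: fact_Suc)
  finally show ?thesis using m(2) by (intro that)
qed

text \<open>
  For \<open>l > 0\<close> write \<open>2\<^bsup>l+1\<^esup> (l + 1)! = 2\<^bsup>p\<^esup> m\<close> with \<open>m\<close> odd and \<open>p = p_exp l\<close>. Then
  \<open>2\<^bsup>p\<^esup> m C l\<close> is an integer of the parity of \<open>l\<close>. Since \<open>C l\<close> is dyadic, \<open>m\<close> divides that
  integer, and dividing by the odd number \<open>m\<close> preserves the parity.
\<close>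

lemma inverse_inf_numerator:
  fixes B C :: "nat \<Rightarrow> 'a::field_char_0"
  assumes inv: "compose_inf (laurent_inf C) (laurent_inf B) = fls_X_inv"
    and B: "\<And>l. \<exists>R::int. odd R \<and> B l = of_int R / 2 ^ p_exp l"
  shows "\<exists>J::int. C l * 2 ^ p_exp l = of_int J \<and> (odd J \<longleftrightarrow> l = 0 \<or> odd l)"
proof (cases "l = 0")
  case True
  obtain R :: int where "odd R" "B 0 = of_int R / 2 ^ p_exp 0" using B by blast
  thus ?thesis
    by (intro exI[of _ "- R"]) (simp add: True inverse_inf_nth_0[OF inv])
next
  case False
  hence l: "l > 0" by simp
  have "\<exists>a. odd a \<and> 2 ^ Suc k * fact (Suc k) * B k = of_int a" for k
  proof -
    obtain R :: int where R: "odd R" "B k = of_int R / 2 ^ p_exp k" using B by blast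
    obtain m :: int where m: "odd m" "2 ^ Suc k * fact (Suc k) = 2 ^ p_exp k * m"
      by (rule two_power_fact_conv_p_exp)
    have "2 ^ Suc k * fact (Suc k) * B k = of_int (2 ^ Suc k * fact (Suc k)) * B k"
      by (simp only: of_int_mult of_int_power of_int_numeral of_int_fact)
    also have "\<dots> = of_int (m * R)"
      by (simp only: m(2)) (simp add: R(2))
    finally show ?thesis using m R by (intro exI[of _ "m * R"]) simp
  qed
  from inverse_inf_mod_2[OF inv this l] obtain K
    where K: "2 ^ Suc l * fact (Suc l) * C l = of_int K" "odd K \<longleftrightarrow> odd l"
    by blast
  have "dyadic (B k)" for k
    using B[of k] unfolding dyadic_def by (intro exI[of _ "p_exp k"]) auto
  from dyadic_inverse_inf[OF inv this l] obtain j :: nat and a :: int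
    where a: "C l * 2 ^ j = of_int a"
    unfolding dyadic_def by blast
  obtain m :: int where m: "odd m" "2 ^ Suc l * fact (Suc l) = 2 ^ p_exp l * m"
    by (rule two_power_fact_conv_p_exp)
  have "(2 ^ Suc l * fact (Suc l) :: 'a) = of_int (2 ^ Suc l * fact (Suc l))"
    by (simp only: of_int_mult of_int_power of_int_numeral of_int_fact)
  hence Km: "C l * 2 ^ p_exp l * of_int m = of_int K"
    using K(1) unfolding m(2) by (simp add: mult_ac)
  have "(of_int (K * 2 ^ j) :: 'a) = C l * 2 ^ j * (2 ^ p_exp l * of_int m)"
    by (simp add: Km [symmetric] mult_ac)
  also have "\<dots> = of_int (a * 2 ^ p_exp l * m)"
    by (simp add: a)
  finally have "K * 2 ^ j = a * 2 ^ p_exp l * m"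
    by (simp only: of_int_eq_iff)
  hence "m dvd K * 2 ^ j" by simp
  moreover have "coprime m (2 ^ j)" using m(1) by simp
  ultimately have "m dvd K" by (simp add: coprime_dvd_mult_left_iff)
  then obtain J where J: "K = J * m" by (metis dvd_div_mult_self)
  have "C l * 2 ^ p_exp l = of_int J"
    using Km m(1) by (auto simp: J)
  thus ?thesis using J K(2) m(1) False by auto
qed

theorem theorem1p4:
  fixes B C :: "nat \<Rightarrow> 'a::field_char_0"
  assumes inv: "formal_inverse_inf (laurent_inf B) (laurent_inf C)"
    and B: "\<And>l. \<exists>R::int. odd R \<and> B l = of_int R / 2 ^ p_exp l"
  shows "\<forall>l. (C l = 0 \<or>
               (\<exists>(K::int) (q::int). odd K \<and> C l = of_int K / 2 powi q \<and> q \<le> int (p_exp l)))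
           \<and> ((C l \<noteq> 0 \<and>
               (\<exists>(K::int) (q::int). odd K \<and> C l = of_int K / 2 powi q \<and> q = int (p_exp l)))
              \<longleftrightarrow> l = 0 \<or> odd l)"
proof
  fix l
  have "compose_inf (laurent_inf C) (laurent_inf B) = fls_X_inv"
    using inv by (simp add: formal_inverse_inf_def)
  from inverse_inf_numerator[OF this B] obtain J :: int
    where J: "C l * 2 ^ p_exp l = of_int J" "odd J \<longleftrightarrow> l = 0 \<or> odd l"
    by blast
  have C: "C l = of_int J / 2 powi int (p_exp l)"
    by (simp add: J(1) [symmetric])
  have "\<exists>(K::int) (q::int). odd K \<and> C l = of_int K / 2 powi q \<and> q \<le> int (p_exp l)" if "C l \<noteq> 0"
  proof -
    from that have "J \<noteq> 0" using C by auto
    obtain K where K: "J = 2 ^ ord2 J * K" "odd K"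
      using multiplicity_decompose'[of J "2::int"] \<open>J \<noteq> 0\<close> by auto
    have "C l = 2 ^ ord2 J * of_int K / 2 powi int (p_exp l)"
      using arg_cong[OF K(1), of "of_int :: int \<Rightarrow> 'a"] by (simp add: C)
    also have "\<dots> = of_int K / 2 powi (int (p_exp l) - int (ord2 J))"
      by (simp add: power_int_diff)
    finally show ?thesis
      using K(2) by (intro exI[of _ K] exI[of _ "int (p_exp l) - int (ord2 J)"]) simp
  qed
  moreover have "C l \<noteq> 0 \<and>
      (\<exists>(K::int) (q::int). odd K \<and> C l = of_int K / 2 powi q \<and> q = int (p_exp l)) \<longleftrightarrow> odd J"
  proof
    assume "odd J"
    hence "J \<noteq> 0" by auto
    thus "C l \<noteq> 0 \<and>
        (\<exists>(K::int) (q::int). odd K \<and> C l = of_int K / 2 powi q \<and> q = int (p_exp l))"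
      using C \<open>odd J\<close> by auto
  next
    assume "C l \<noteq> 0 \<and>
        (\<exists>(K::int) (q::int). odd K \<and> C l = of_int K / 2 powi q \<and> q = int (p_exp l))"
    then obtain K :: int where "odd K" "C l = of_int K / 2 powi int (p_exp l)" by blast
    thus "odd J" using C by simp
  qed
  ultimately show "(C l = 0 \<or>
        (\<exists>(K::int) (q::int). odd K \<and> C l = of_int K / 2 powi q \<and> q \<le> int (p_exp l)))
      \<and> ((C l \<noteq> 0 \<and>
        (\<exists>(K::int) (q::int). odd K \<and> C l = of_int K / 2 powi q \<and> q = int (p_exp l)))
          \<longleftrightarrow> l = 0 \<or> odd l)"
    using J(2) by blast
qed

end
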